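(* Let $\mathcal{C}_1,\mathcal{C}_2\subset\mathbb{R}^3$ be rational curves with proper parametrizations $\boldsymbol{x}_1(t),\boldsymbol{x}_2(s)$, where $\mathcal{C}_2$ is contained in a plane $\Pi$, satisfying the standing assumptions in the context. Let $\tilde{\mathbf a}\in\mathbb{P}^3_{\mathbb{R}}$ be such that $\mathcal{C}_2=\mathcal{P}_{\tilde{\mathbf a}}(\mathcal{C}_1)$. Then there exists a real rational function $\psi(t)$ such that $\mathcal{P}_{\tilde{\mathbf a}}\circ\boldsymbol{x}_1=\boldsymbol{x}_2\circ\psi$ (as an identity of rational maps). Furthermore, if the projection $\mathcal{P}_{\tilde{\mathbf a}}$ of $\mathcal{C}_1$ onto $\mathcal{C}_2$ is non-degenerate, then $\psi(t)$ is a Möbius transformation, i.e. $\psi(t)=\frac{at+b}{ct+d}$ with $ad-bc\neq0$.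
   Context: Standing assumptions. $\mathcal{C}_1\neq\mathcal{C}_2$ are rational curves in $\mathbb{R}^3$ with parametrizations $\boldsymbol{x}_j(t)=(x_j(t),y_j(t),z_j(t))$, $j=1,2$, whose components are rational functions with coefficients in $\mathbb{Q}$. The parametrizations are proper: birational onto the curve, equivalently injective except for finitely many parameter values. $\mathcal{C}_2$ is contained in a plane $\Pi$; $\mathcal{C}_1$ is not necessarily planar; $\mathcal{C}_1$ and $\mathcal{C}_2$ are not both contained in one common plane; neither $\mathcal{C}_1$ nor $\mathcal{C}_2$ is a straight line. The parameter $t$ may be taken complex, and each curve is identified with its projective closure in $\mathbb{P}^3_{\mathbb{C}}$. Projections. For a real projective point $\tilde{\mathbf a}=[\tilde a_1:\tilde a_2:\tilde a_3:\tilde a_4]\in\mathbb{P}^3_{\mathbb{R}}$ (the eye point) not lying on the projective closure of $\Pi$, $\mathcal{P}_{\tilde{\mathbf a}}$ is the projection onto $\Pi$ from $\tilde{\mathbf a}$: it maps a point $\boldsymbol p\ne\tilde{\mathbf a}$ of $\mathbb{P}^3_{\mathbb{C}}$ to the intersection of (the projective closure of) $\Pi$ with the line through $\tilde{\mathbf a}$ and $\boldsymbol p$. It is a perspective projection if $\tilde a_4\neq0$ and a parallel projection if $\tilde a_4=0$. "$\mathcal{C}_2=\mathcal{P}_{\tilde{\mathbf a}}(\mathcal{C}_1)$" means that every (complex projective) point of $\mathcal{C}_2$ is the projection of some (complex projective) point of $\mathcal{C}_1$. In this case the projection is called non-degenerate if, for almost all (all but finitely many) points of $\mathcal{C}_2$,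 there is only one complex projective point of $\mathcal{C}_1$ projecting onto it. *)

theory Defs
  imports "HOL-Analysis.Analysis" "HOL-Computational_Algebra.Field_as_Ring"
    "HOL-Computational_Algebra.Normalized_Fraction" "HOL-Computational_Algebra.Polynomial_Factorial"
begin

section \<open>Projective space\<close>

definition proj_rel :: "'a::field ^ 'n \<Rightarrow> 'a ^ 'n \<Rightarrow> bool" where
  "proj_rel u v \<longleftrightarrow> u \<noteq> 0 \<and> v \<noteq> 0 \<and> (\<exists>c. c \<noteq> 0 \<and> v = c *s u)"

lemma proj_rel_part_equivp: "part_equivp (proj_rel :: 'a::field ^ 'n \<Rightarrow> _)"
proof (rule part_equivpI)
  show "\<exists>x::'a ^ 'n. proj_rel x x"
    by (rule exI[of _ "\<chi> i. 1"]) (auto simp: proj_rel_def vec_eq_iff intro!: exI[of _ 1])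
  show "symp (proj_rel :: 'a ^ 'n \<Rightarrow> _)"
  proof (rule sympI)
    fix u v :: "'a ^ 'n" assume "proj_rel u v"
    then obtain c where "u \<noteq> 0" "v \<noteq> 0" "c \<noteq> 0" "v = c *s u"
      by (auto simp: proj_rel_def)
    then show "proj_rel v u"
      by (auto simp: proj_rel_def vec_eq_iff intro!: exI[of _ "inverse c"])
  qed
  show "transp (proj_rel :: 'a ^ 'n \<Rightarrow> _)"
  proof (rule transpI)
    fix u v w :: "'a ^ 'n" assume "proj_rel u v" "proj_rel v w"
    then obtain c d where "u \<noteq> 0" "w \<noteq> 0" "c \<noteq> 0" "d \<noteq> 0" "w = d *s (c *s u)"
      by (auto simp: proj_rel_def)
    then show "proj_rel u w"
      by (auto simp: proj_rel_def vec_eq_iff mult.assoc intro!: exI[of _ "d * c"])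
  qed
qed

text \<open>The type \<open>('a, 'n) proj\<close> is the projective space of dimension \<open>CARD('n) - 1\<close>
  over the field \<open>'a\<close>; thus \<open>(complex, 4) proj\<close> is projective 3-space over the complex
  numbers. In \<open>'a ^ 4\<close> the last homogeneous coordinate is \<open>v $ 4\<close>.\<close>

quotient_type (overloaded) ('a, 'n) proj = "'a::field ^ 'n::finite" / partial: proj_rel
  by (rule proj_rel_part_equivp)

lemma vector_4:
  "(vector [x, y, z, w] :: 'a::zero ^ 4) $ 1 = x"
  "(vector [x, y, z, w] :: 'a::zero ^ 4) $ 2 = y"
  "(vector [x, y, z, w] :: 'a::zero ^ 4) $ 3 = z"
  "(vector [x, y, z, w] :: 'a::zero ^ 4) $ 4 = w"
  unfolding vector_def by simp_all

lift_definition affine_point :: "'a::field ^ 3 \<Rightarrow> ('a, 4) proj"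
  is "\<lambda>v. vector [v $ 1, v $ 2, v $ 3, 1]"
  by (auto simp: proj_rel_def vec_eq_iff forall_4 vector_4 intro!: exI[of _ 1])

lift_definition complexify :: "(real, 'n::finite) proj \<Rightarrow> (complex, 'n) proj"
  is "\<lambda>v. \<chi> i. complex_of_real (v $ i)"
proof -
  fix u v :: "real ^ 'n" assume "proj_rel u v"
  then obtain c where "u \<noteq> 0" "v \<noteq> 0" "c \<noteq> 0" "v = c *s u"
    by (auto simp: proj_rel_def)
  then show "proj_rel (\<chi> i. complex_of_real (u $ i)) (\<chi> i. complex_of_real (v $ i))"
    by (auto simp: proj_rel_def vec_eq_iff intro!: exI[of _ "complex_of_real c"])
qed

lift_definition on_line ::
  "('a::field, 'n::finite) proj \<Rightarrow> ('a, 'n) proj \<Rightarrow> ('a, 'n) proj \<Rightarrow> bool"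
  is "\<lambda>u v w. \<exists>c d. w = c *s u + d *s v"
proof -
  fix u u' v v' w w' :: "'a ^ 'n"
  assume uvw: "proj_rel u u'" "proj_rel v v'" "proj_rel w w'"
  have step: "\<exists>c d. w' = c *s u' + d *s v'"
    if rels: "proj_rel u u'" "proj_rel v v'" "proj_rel w w'" and ex: "\<exists>c d. w = c *s u + d *s v"
    for u u' v v' w w' :: "'a ^ 'n"
  proof -
    from rels obtain a b e where *: "a \<noteq> 0" "b \<noteq> 0" "u' = a *s u" "v' = b *s v" "w' = e *s w"
      by (auto simp: proj_rel_def)
    from ex obtain c d where "w = c *s u + d *s v" by blast
    with * have "w' = (e * c / a) *s u' + (e * d / b) *s v'"
      by (simp add: vec_eq_iff field_simps)
    then show ?thesis by blast
  qed
  have "proj_rel u' u" "proj_rel v' v" "proj_rel w' w"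
    using uvw part_equivp_symp[OF proj_rel_part_equivp] by blast+
  then show "(\<exists>c d. w = c *s u + d *s v) = (\<exists>c d. w' = c *s u' + d *s v')"
    using step[of u u' v v' w w'] step[of u' u v' v w' w] uvw by blast
qed

definition proj_line :: "('a::field, 'n::finite) proj \<Rightarrow> ('a, 'n) proj \<Rightarrow> ('a, 'n) proj set" where
  "proj_line p q = {r. on_line p q r}"


section \<open>Forms and projective closure\<close>

text \<open>The form of degree \<open>d\<close> whose coefficient at the monomial with exponents \<open>e\<close> is \<open>F e\<close>;
  coefficients at exponents of total degree other than \<open>d\<close> are ignored.\<close>

definition form :: "nat \<Rightarrow> (('n::finite \<Rightarrow> nat) \<Rightarrow> 'a::field) \<Rightarrow> 'a ^ 'n \<Rightarrow> 'a" where
  "form d F v = (\<Sum>e | (\<Sum>i\<in>UNIV. e i) = d. F e * (\<Prod>i\<in>UNIV. (v $ i) ^ e i))"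

lemma finite_exponents: "finite {e :: 'n::finite \<Rightarrow> nat. (\<Sum>i\<in>UNIV. e i) = d}"
proof (rule finite_subset)
  show "{e :: 'n \<Rightarrow> nat. (\<Sum>i\<in>UNIV. e i) = d} \<subseteq> UNIV \<rightarrow>\<^sub>E {..d}"
    by (auto intro: member_le_sum)
  show "finite (UNIV \<rightarrow>\<^sub>E {..d} :: ('n \<Rightarrow> nat) set)"
    by (intro finite_PiE) auto
qed

lemma form_scale: "form d F (c *s v) = c ^ d * form d F v"
proof -
  have "F e * (\<Prod>i\<in>UNIV. (c * v $ i) ^ e i) = c ^ d * (F e * (\<Prod>i\<in>UNIV. (v $ i) ^ e i))"
    if "(\<Sum>i\<in>UNIV. e i) = d" for e
    using that by (auto simp: power_mult_distrib prod.distrib simp flip: power_sum)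
  then show ?thesis
    unfolding form_def sum_distrib_left by (intro sum.cong) auto
qed

lift_definition vanishes_at ::
  "nat \<Rightarrow> (('n::finite \<Rightarrow> nat) \<Rightarrow> 'a::field) \<Rightarrow> ('a, 'n) proj \<Rightarrow> bool"
  is "\<lambda>d F v. form d F v = 0"
  by (auto simp: proj_rel_def form_scale)

lift_definition form_quotient ::
  "nat \<Rightarrow> (('n::finite \<Rightarrow> nat) \<Rightarrow> 'a::field) \<Rightarrow> (('n \<Rightarrow> nat) \<Rightarrow> 'a) \<Rightarrow> ('a, 'n) proj \<Rightarrow> 'a"
  is "\<lambda>d F G v. form d F v / form d G v"
  by (auto simp: proj_rel_def form_scale)

text \<open>Projective (Zariski) closure, in complex projective 3-space, of a set of real affine points.\<close>

definition proj_closure :: "(real ^ 3) set \<Rightarrow> (complex, 4) proj set" where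
  "proj_closure S = {p. \<forall>d F. (\<forall>v\<in>S. vanishes_at d F (complexify (affine_point v)))
                          \<longrightarrow> vanishes_at d F p}"

definition is_plane :: "(real ^ 3) set \<Rightarrow> bool" where
  "is_plane S \<longleftrightarrow> affine S \<and> aff_dim S = 2"

definition is_straight_line :: "(real ^ 3) set \<Rightarrow> bool" where
  "is_straight_line S \<longleftrightarrow> affine S \<and> aff_dim S = 1"


section \<open>Rational functions and rational curves\<close>

text \<open>Rational functions over \<open>'k\<close> are elements of \<open>'k poly fract\<close>. They are evaluated in an
  extension field along an embedding \<open>h\<close> (below \<open>of_rat\<close> or \<open>of_real\<close>), using the reduced
  fraction; hence \<open>ratfun_dom\<close> is the complement of the set of poles.\<close>

definition ratfun_dom ::
  "('k::{factorial_ring_gcd,semiring_gcd_mult_normalize} \<Rightarrow> 'a::field) \<Rightarrow> 'k poly fract \<Rightarrow> 'a set"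
  where "ratfun_dom h r = {t. poly (map_poly h (snd (quot_of_fract r))) t \<noteq> 0}"

definition ratfun ::
  "('k::{factorial_ring_gcd,semiring_gcd_mult_normalize} \<Rightarrow> 'a::field) \<Rightarrow> 'k poly fract \<Rightarrow> 'a \<Rightarrow> 'a"
  where "ratfun h r t = poly (map_poly h (fst (quot_of_fract r))) t /
                        poly (map_poly h (snd (quot_of_fract r))) t"

definition param_dom :: "rat poly fract ^ 3 \<Rightarrow> 'a::field_char_0 set" where
  "param_dom x = {t. \<forall>i. t \<in> ratfun_dom of_rat (x $ i)}"

definition param :: "rat poly fract ^ 3 \<Rightarrow> 'a::field_char_0 \<Rightarrow> 'a ^ 3" where
  "param x t = (\<chi> i. ratfun of_rat (x $ i) t)"

definition real_curve :: "rat poly fract ^ 3 \<Rightarrow> (real ^ 3) set" where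
  "real_curve x = param x ` param_dom x"

definition curve :: "rat poly fract ^ 3 \<Rightarrow> (complex, 4) proj set" where
  "curve x = proj_closure (real_curve x)"

text \<open>Proper means birational onto the curve: there is a rational function \<open>F / G\<close> on the curve
  that is inverse to the parametrization, both compositions being the identity outside finitely
  many parameter values and finitely many points of the curve, respectively.\<close>

definition proper_param :: "rat poly fract ^ 3 \<Rightarrow> bool" where
  "proper_param x \<longleftrightarrow> (\<exists>d F G.
     (\<forall>\<^sub>\<infinity>t::complex. t \<in> param_dom x \<and>
        \<not> vanishes_at d G (affine_point (param x t)) \<and>
        form_quotient d F G (affine_point (param x t)) = t) \<and>
     finite {p \<in> curve x. \<not> (\<not> vanishes_at d G p \<and>
        form_quotient d F G p \<in> param_dom x \<and>
        affine_point (param x (form_quotient d F G p)) = p)})"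


section \<open>Projections onto a plane\<close>

text \<open>Only meaningful if \<open>P\<close> is a plane, \<open>a\<close> is not on its projective closure and \<open>p \<noteq> a\<close>.\<close>

definition projection ::
  "(real ^ 3) set \<Rightarrow> (real, 4) proj \<Rightarrow> (complex, 4) proj \<Rightarrow> (complex, 4) proj" where
  "projection P a p = (THE q. q \<in> proj_closure P \<inter> proj_line (complexify a) p)"

definition projects_onto ::
  "(real ^ 3) set \<Rightarrow> (real, 4) proj \<Rightarrow> (complex, 4) proj set \<Rightarrow> (complex, 4) proj set \<Rightarrow> bool" where
  "projects_onto P a C D \<longleftrightarrow> (\<forall>q\<in>D. \<exists>p\<in>C. p \<noteq> complexify a \<and> projection P a p = q)"

definition nondegenerate_projection ::
  "(real ^ 3) set \<Rightarrow> (real, 4) proj \<Rightarrow> (complex, 4) proj set \<Rightarrow> (complex, 4) proj set \<Rightarrow> bool" where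
  "nondegenerate_projection P a C D \<longleftrightarrow>
     finite {q \<in> D. \<not> (\<exists>!p. p \<in> C \<and> p \<noteq> complexify a \<and> projection P a p = q)}"

definition moebius_transformation :: "real poly fract \<Rightarrow> bool" where
  "moebius_transformation r \<longleftrightarrow>
     (\<exists>a b c d. a * d - b * c \<noteq> 0 \<and> r = Fract [:b, a:] [:d, c:])"

end

theory Submission
  imports Defs "HOL-Computational_Algebra.Fundamental_Theorem_Algebra"
begin

text \<open>In homogeneous coordinates the projection from \<open>[\<alpha>]\<close> onto the plane \<open>\<ell> = 0\<close> is
  \<open>u \<mapsto> \<ell>(\<alpha>) u - \<ell>(u) \<alpha>\<close>, so the projected first curve has a polynomial parametrization
  \<open>V(t)\<close>. Infinitely many of its points lie on the second curve, hence all of them do, and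
  composing with the rational inverse \<open>F / G\<close> of the second parametrization gives
  \<open>\<psi> = F(V) / G(V)\<close>. This \<psi> maps almost all real numbers to real numbers, because complex
  conjugation fixes real points and the second parametrization is injective; hence it has real
  coefficients. If the projection is non-degenerate, \<psi> is injective off a finite set, and a
  rational function over \<complex> with this property has degree one.\<close>

section \<open>Polynomials and rational functions\<close>

lemma MOST_poly_nonzero:
  fixes p :: "'a::idom poly"
  assumes "p \<noteq> 0"
  shows "\<forall>\<^sub>\<infinity>t. poly p t \<noteq> 0"
  using poly_roots_finite[OF assms] by (simp add: eventually_cofinite)

lemma poly_eq_0_if_infinite_roots:
  fixes p :: "'a::idom poly"
  assumes "infinite {t. poly p t = 0}"
  shows "p = 0"
  using assms poly_roots_finite by blast

lemma poly_map_poly_mult: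
  fixes h :: "'a::comm_ring_1 \<Rightarrow> 'b::comm_ring_1"
  assumes h: "h 0 = 0" "\<And>x y. h (x + y) = h x + h y" "\<And>x y. h (x * y) = h x * h y"
  shows "poly (map_poly h (p * q)) t = poly (map_poly h p) t * poly (map_poly h q) t"
proof -
  have add: "map_poly h (u + v) = map_poly h u + map_poly h v" for u v
    by (rule poly_eqI) (simp add: coeff_map_poly h)
  have "map_poly h (p * q) = map_poly h p * map_poly h q"
  proof (induction p)
    case 0
    then show ?case by simp
  next
    case (pCons a p)
    then show ?case
      by (simp add: map_poly_pCons h add map_poly_smult algebra_simps)
  qed
  then show ?thesis by simp
qed

lemma map_poly_of_real_eq_0_iff [simp]:
  "map_poly (of_real :: real \<Rightarrow> complex) p = 0 \<longleftrightarrow> p = 0"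
  by (rule map_poly_eq_0_iff) auto

lemma map_poly_of_real_add:
  "map_poly of_real (p + q) = (map_poly of_real p + map_poly of_real q :: complex poly)"
  by (rule poly_eqI) (simp add: coeff_map_poly)

lemma poly_map_poly_of_real: "poly (map_poly of_real p) (of_real t :: complex) = of_real (poly p t)"
  by (induction p) (auto simp: map_poly_pCons)

lemma complex_of_rat: "complex_of_rat r = of_real (of_rat r)"
  by (cases r) (simp add: of_rat_rat)

lemma poly_map_poly_of_rat:
  "poly (map_poly of_rat p) (of_real t :: complex) = of_real (poly (map_poly of_rat p) t)"
  by (induction p) (auto simp: map_poly_pCons complex_of_rat)

lemma poly_map_poly_of_rat_cnj:
  "poly (map_poly of_rat p) (cnj t) = cnj (poly (map_poly of_rat p) t)"
  by (subst poly_cnj_real) (auto simp: coeff_map_poly complex_of_rat)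

text \<open>\<open>ratfun\<close> evaluates the reduced fraction, which differs from
  \<open>n\<close> and \<open>d\<close> by a common factor \<open>g\<close>. Off the roots of
  \<open>d\<close> this factor is nonzero and cancels.\<close>

lemma MOST_ratfun_Fract:
  fixes n d :: "real poly"
  assumes "d \<noteq> 0"
  shows "\<forall>\<^sub>\<infinity>t::complex. t \<in> ratfun_dom of_real (Fract n d) \<and>
    ratfun of_real (Fract n d) t = poly (map_poly of_real n) t / poly (map_poly of_real d) t"
proof -
  obtain g where g: "n = fst (normalize_quot (n, d)) * g" "d = snd (normalize_quot (n, d)) * g"
    using normalize_quotE[OF assms, of n] by metis
  have q: "quot_of_fract (Fract n d) = normalize_quot (n, d)"
    using quot_of_fract_quot_to_fract[of "(n, d)"] assms by (simp add: quot_to_fract_def)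
  have "\<forall>\<^sub>\<infinity>t::complex. poly (map_poly of_real d) t \<noteq> 0"
    using assms by (intro MOST_poly_nonzero) simp
  then show ?thesis
  proof (rule MOST_mono)
    fix t :: complex
    define n' d' where "n' = fst (normalize_quot (n, d))" and "d' = snd (normalize_quot (n, d))"
    have n: "poly (map_poly of_real n) t = poly (map_poly of_real n') t * poly (map_poly of_real g) t"
      by (subst g(1)) (simp add: poly_map_poly_mult n'_def)
    have d: "poly (map_poly of_real d) t = poly (map_poly of_real d') t * poly (map_poly of_real g) t"
      by (subst g(2)) (simp add: poly_map_poly_mult d'_def)
    assume "poly (map_poly of_real d) t \<noteq> 0"
    with d have "poly (map_poly of_real d') t \<noteq> 0" "poly (map_poly of_real g) t \<noteq> 0"
      by auto
    then show "t \<in> ratfun_dom of_real (Fract n d) \<and>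
        ratfun of_real (Fract n d) t = poly (map_poly of_real n) t / poly (map_poly of_real d) t"
      by (simp add: ratfun_dom_def ratfun_def q n d flip: n'_def d'_def)
  qed
qed

text \<open>\<open>q\<close> and \<open>r\<close> collect the real and imaginary parts of the
  coefficients, not of the values, so the splitting also holds at non-real \<open>t\<close>.\<close>

lemma complex_poly_Re_Im:
  fixes p :: "complex poly"
  obtains q r :: "real poly"
  where "\<And>t. poly p t = poly (map_poly of_real q) t + \<i> * poly (map_poly of_real r) t"
proof -
  have "\<exists>q r :: real poly. \<forall>t. poly p t = poly (map_poly of_real q) t + \<i> * poly (map_poly of_real r) t"
  proof (induction p)
    case 0
    show ?case by (rule exI[of _ 0], rule exI[of _ 0]) simp
  next
    case (pCons a p)
    then obtain q r :: "real poly"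
      where qr: "\<forall>t. poly p t = poly (map_poly of_real q) t + \<i> * poly (map_poly of_real r) t"
      by blast
    show ?case
    proof (intro exI allI)
      fix t
      show "poly (pCons a p) t = poly (map_poly of_real (pCons (Re a) q)) t
          + \<i> * poly (map_poly of_real (pCons (Im a) r)) t"
        using qr by (simp add: map_poly_pCons algebra_simps) (rule complex_eq)
    qed
  qed
  then show ?thesis using that by blast
qed

text \<open>With \<open>N = N1 + \<i> N2\<close> and \<open>D = D1 + \<i> D2\<close>, the real polynomial
  \<open>N2 D1 - N1 D2\<close> has infinitely many zeros, so that
  \<open>N / D = (N1 D1 + N2 D2) / (D1\<^sup>2 + D2\<^sup>2)\<close>.\<close>

lemma real_ratfun_exists:
  fixes N D :: "complex poly"
  assumes "D \<noteq> 0"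
    and inf: "infinite {t::real. poly N (of_real t) / poly D (of_real t) \<in> \<real>
                                  \<and> poly D (of_real t) \<noteq> 0}"
  shows "\<exists>\<psi> :: real poly fract. \<forall>\<^sub>\<infinity>t::complex.
     t \<in> ratfun_dom of_real \<psi> \<and> ratfun of_real \<psi> t = poly N t / poly D t"
proof -
  obtain N1 N2 :: "real poly"
    where N: "\<And>t. poly N t = poly (map_poly of_real N1) t + \<i> * poly (map_poly of_real N2) t"
    using complex_poly_Re_Im by blast
  obtain D1 D2 :: "real poly"
    where D: "\<And>t. poly D t = poly (map_poly of_real D1) t + \<i> * poly (map_poly of_real D2) t"
    using complex_poly_Re_Im by blast
  have eq_aux: "(n1 + j * n2) * (d1 * d1 + d2 * d2) = (d1 + j * d2) * (n1 * d1 + n2 * d2)"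
    if "n2 * d1 = n1 * d2" for n1 n2 d1 d2 j :: complex
    using that by algebra
  have cross: "N2 * D1 = N1 * D2"
  proof -
    have "{t::real. poly N (of_real t) / poly D (of_real t) \<in> \<real> \<and> poly D (of_real t) \<noteq> 0}
          \<subseteq> {t. poly (N2 * D1 - N1 * D2) t = 0}"
    proof safe
      fix t :: real
      assume r: "poly N (of_real t) / poly D (of_real t) \<in> \<real>" and nz: "poly D (of_real t) \<noteq> 0"
      from r obtain c where "poly N (of_real t) / poly D (of_real t) = of_real c"
        by (auto elim: Reals_cases)
      with nz have "poly N (of_real t) = of_real c * poly D (of_real t)"
        by (simp add: field_simps)
      then have "poly N1 t = c * poly D1 t" "poly N2 t = c * poly D2 t"
        unfolding N D by (auto simp: poly_map_poly_of_real complex_eq_iff)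
      then show "poly (N2 * D1 - N1 * D2) t = 0" by simp
    qed
    with inf have "N2 * D1 - N1 * D2 = 0"
      by (intro poly_eq_0_if_infinite_roots) (meson finite_subset)
    then show ?thesis by simp
  qed
  define n d where "n = N1 * D1 + N2 * D2" and "d = D1 * D1 + D2 * D2"
  \<comment> \<open>Over the reals a sum of two squares vanishes only if both squares do, so
    \<open>d = 0\<close> would force \<open>D1 = D2 = 0\<close>.\<close>
  have "d \<noteq> 0"
  proof
    assume "d = 0"
    then have z: "poly D1 t * poly D1 t + poly D2 t * poly D2 t = 0" for t
      unfolding d_def by (metis poly_0 poly_add poly_mult)
    have "poly D1 t = 0 \<and> poly D2 t = 0" for t
      using z[of t] by (simp add: sum_squares_eq_zero_iff)
    then have "D1 = 0" "D2 = 0"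
      by (metis poly_all_0_iff_0)+
    then have "\<forall>t. poly D t = 0" unfolding D by simp
    with \<open>D \<noteq> 0\<close> show False by (simp add: poly_all_0_iff_0)
  qed
  have "\<forall>\<^sub>\<infinity>t::complex. poly (map_poly of_real d) t \<noteq> 0"
    using \<open>d \<noteq> 0\<close> by (intro MOST_poly_nonzero) simp
  with MOST_ratfun_Fract[OF \<open>d \<noteq> 0\<close>, of n] MOST_poly_nonzero[OF \<open>D \<noteq> 0\<close>]
  have "\<forall>\<^sub>\<infinity>t::complex. t \<in> ratfun_dom of_real (Fract n d)
      \<and> ratfun of_real (Fract n d) t = poly N t / poly D t"
  proof eventually_elim
    case (elim t)
    let ?p = "\<lambda>p. poly (map_poly complex_of_real p) t"
    have c: "?p N2 * ?p D1 = ?p N1 * ?p D2"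
      using arg_cong[OF cross, of ?p] by (simp add: poly_map_poly_mult)
    have "poly N t * ?p d = poly D t * ?p n"
      using c unfolding N D n_def d_def by (simp add: map_poly_of_real_add poly_map_poly_mult eq_aux)
    with elim show ?case by (simp add: frac_eq_eq mult.commute)
  qed
  then show ?thesis by blast
qed

text \<open>Every nonconstant complex polynomial has a root. After splitting off
  \<open>X - c\<close>, the cofactor still has one, which must again be \<open>c\<close>; so
  \<open>c\<close> is a multiple root.\<close>

lemma poly_single_root_pderiv:
  fixes R :: "complex poly"
  assumes "degree R \<ge> 2" and root: "\<And>z. poly R z = 0 \<Longrightarrow> z = c"
  shows "poly (pderiv R) c = 0"
proof -
  have ex: "\<exists>z. poly Q z = 0" if "degree Q \<ge> 1" for Q :: "complex poly"
    using that by (intro fundamental_theorem_of_algebra) (auto simp: constant_degree)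
  from ex[of R] root assms(1) have "poly R c = 0" by force
  then obtain S where S: "R = [:- c, 1:] * S"
    by (auto simp: poly_eq_0_iff_dvd elim: dvdE)
  with assms(1) have "S \<noteq> 0" by auto
  with S assms(1) have "degree S \<ge> 1"
    by (simp add: degree_mult_eq del: mult_pCons_left)
  with ex obtain z where z: "poly S z = 0" by blast
  with S root have "z = c" by simp
  with z show ?thesis unfolding S by (simp add: pderiv_mult pderiv_pCons del: mult_pCons_left)
qed

text \<open>If the degree were at least 2, then for generic \<open>c\<close> the polynomial
  \<open>N(t) D(c) - N(c) D(t)\<close> would have \<open>c\<close> as its only root, hence as a multiple root. Thus the
  Wronskian \<open>N' D - N D'\<close> would vanish at almost all \<open>c\<close>, and \<open>N / D\<close> would be constant.\<close>

lemma degree_le_1_if_injective: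
  fixes N D :: "complex poly"
  assumes cop: "coprime N D" and "D \<noteq> 0" and "finite E"
    and inj: "inj_on (\<lambda>t. poly N t / poly D t) (- E)"
  shows "degree N \<le> 1 \<and> degree D \<le> 1"
proof (rule ccontr)
  define m where "m = max (degree N) (degree D)"
  assume "\<not> (degree N \<le> 1 \<and> degree D \<le> 1)"
  then have m: "m \<ge> 2" by (auto simp: m_def)
  define f where "f = (\<lambda>t. poly N t / poly D t)"
  have noroot: "poly N t \<noteq> 0" if "poly D t = 0" for t
  proof
    assume "poly N t = 0"
    with that have "[:- t, 1:] dvd N" "[:- t, 1:] dvd D"
      by (simp_all add: poly_eq_0_iff_dvd)
    with cop have "is_unit [:- t, 1:]" using coprime_common_divisor by blast
    then show False by (simp add: is_unit_pCons_iff)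
  qed
  have single: "\<forall>\<^sub>\<infinity>c. f c \<noteq> v" for v
  proof -
    have "finite (f -` {v} \<inter> - E \<union> E)"
      using inj[folded f_def] \<open>finite E\<close> by (simp add: finite_vimage_IntI)
    then show ?thesis unfolding eventually_cofinite by (rule rev_finite_subset) auto
  qed
  \<comment> \<open>\<open>poly L c\<close> is the coefficient of degree \<open>m\<close> in the
    polynomial \<open>R\<close> formed below. Once \<open>L\<close> is nonzero, \<open>R\<close> has
    degree at least \<open>m\<close> for almost all \<open>c\<close>; \<open>L = 0\<close> would
    make \<open>f\<close> constant off its poles.\<close>
  define L where "L = smult (coeff N m) D - smult (coeff D m) N"
  have lead: "coeff N m \<noteq> 0 \<or> coeff D m \<noteq> 0"
    using m unfolding m_def by (metis degree_0 leading_coeff_0_iff max_def not_numeral_le_zero)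
  have "L \<noteq> 0"
  proof
    assume "L = 0"
    then have eq: "coeff N m * poly D t = coeff D m * poly N t" for t
      unfolding L_def by (metis diff_eq_eq add_0 poly_smult right_minus_eq)
    show False
    proof (cases "coeff D m = 0")
      case True
      with lead eq have "\<forall>t. poly D t = 0" by simp
      with \<open>D \<noteq> 0\<close> show False by (simp add: poly_all_0_iff_0)
    next
      case False
      have "\<forall>\<^sub>\<infinity>t. f t = coeff N m / coeff D m"
        using MOST_poly_nonzero[OF \<open>D \<noteq> 0\<close>]
        by eventually_elim (use eq False in \<open>simp add: f_def field_simps\<close>)
      with single[of "coeff N m / coeff D m"] have "\<forall>\<^sub>\<infinity>t::complex. False"
        by eventually_elim simp
      then show False by (simp add: infinite_UNIV_char_0)
    qed
  qed
  define W where "W = pderiv N * D - N * pderiv D"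
  \<comment> \<open>Injectivity says nothing about a root of \<open>R\<close> inside
    \<open>E\<close>. Discarding every \<open>c\<close> that shares its value with a point of
    \<open>E\<close> excludes such roots.\<close>
  have fe: "\<forall>\<^sub>\<infinity>c. \<forall>e\<in>E. f c \<noteq> f e"
    using single \<open>finite E\<close> by (simp add: eventually_ball_finite)
  have "\<forall>\<^sub>\<infinity>c. c \<notin> E" using \<open>finite E\<close> by (simp add: eventually_cofinite)
  with MOST_poly_nonzero[OF \<open>D \<noteq> 0\<close>] MOST_poly_nonzero[OF \<open>L \<noteq> 0\<close>] fe
  have "\<forall>\<^sub>\<infinity>c. poly W c = 0"
  proof eventually_elim
    case (elim c)
    define R where "R = smult (poly D c) N - smult (poly N c) D"
    have "coeff R m = poly L c" by (simp add: R_def L_def algebra_simps)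
    with elim have "degree R \<ge> m" by (intro le_degree) simp
    moreover have "z = c" if "poly R z = 0" for z
    proof -
      from that have eq: "poly D c * poly N z = poly N c * poly D z" by (simp add: R_def)
      have nz: "poly D z \<noteq> 0" using noroot[of z] eq elim by auto
      with eq elim have "f z = f c" by (simp add: f_def field_simps)
      with elim inj[folded f_def] show "z = c" by (metis ComplI inj_onD)
    qed
    ultimately have "poly (pderiv R) c = 0" using m by (intro poly_single_root_pderiv) auto
    then show ?case by (simp add: R_def W_def pderiv_diff pderiv_smult algebra_simps)
  qed
  then have "finite (- {c. poly W c = 0})" by (simp add: eventually_cofinite Compl_eq)
  then have "infinite {c. poly W c = 0}"
    using finite_compl[of "{c. poly W c = 0}"] by (auto simp: infinite_UNIV_char_0)
  then have "W = 0" by (rule poly_eq_0_if_infinite_roots)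
  then have W: "pderiv N * D = N * pderiv D" by (simp add: W_def)
  \<comment> \<open>By coprimality each of \<open>N\<close> and \<open>D\<close> divides its own
    derivative, which in characteristic 0 forces degree 0, against the bound on
    \<open>m\<close>.\<close>
  have "D dvd pderiv D"
    using W cop by (metis coprime_commute coprime_dvd_mult_right_iff dvd_triv_right)
  moreover have "N dvd pderiv N"
    using W cop by (metis coprime_dvd_mult_left_iff dvd_triv_left)
  ultimately have "degree D = 0" "degree N = 0"
    using not_dvd_pderiv[of D] not_dvd_pderiv[of N] by auto
  with m show False by (simp add: m_def)
qed

lemma moebius_if_injective:
  fixes \<psi> :: "real poly fract"
  assumes "finite E" and inj: "inj_on (ratfun of_real \<psi> :: complex \<Rightarrow> complex) (- E)"
  shows "moebius_transformation \<psi>"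
proof -
  define n d where "n = fst (quot_of_fract \<psi>)" and "d = snd (quot_of_fract \<psi>)"
  have \<psi>: "\<psi> = Fract n d" by (simp add: n_def d_def)
  have "d \<noteq> 0" by (simp add: d_def)
  let ?N = "map_poly complex_of_real n" and ?D = "map_poly complex_of_real d"
  have "coprime n d" unfolding n_def d_def by (rule coprime_quot_of_fract)
  \<comment> \<open>Coprimality over the reals passes to the complex numbers through a Bezout
    identity.\<close>
  then obtain u v where "u * n + v * d = 1"
    using bezout_coefficients_fst_snd[of n d] by (metis coprime_imp_gcd_eq_1)
  then have uv: "poly (map_poly complex_of_real (u * n + v * d)) t = 1" for t
    by simp
  have bez: "map_poly of_real u * ?N + map_poly of_real v * ?D = 1"
    using uv by (intro poly_ext) (simp add: map_poly_of_real_add poly_map_poly_mult)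
  have "coprime ?N ?D"
  proof (rule coprimeI)
    fix c assume "c dvd ?N" "c dvd ?D"
    then have "c dvd map_poly of_real u * ?N + map_poly of_real v * ?D" by simp
    with bez show "is_unit c" by simp
  qed
  moreover have f: "(ratfun of_real \<psi> :: complex \<Rightarrow> complex) = (\<lambda>t. poly ?N t / poly ?D t)"
    by (simp add: ratfun_def n_def d_def fun_eq_iff)
  ultimately have "degree ?N \<le> 1 \<and> degree ?D \<le> 1"
    using degree_le_1_if_injective[of ?N ?D E] assms \<open>d \<noteq> 0\<close> by simp
  then have deg: "degree n \<le> 1" "degree d \<le> 1"
    by (simp_all add: degree_map_poly)
  have "\<exists>b a. p = [:b, a:]" if "degree p \<le> 1" for p :: "real poly"
    using that by (intro exI[of _ "coeff p 0"] exI[of _ "coeff p 1"] poly_eqI)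
      (auto simp: coeff_pCons coeff_eq_0 split: nat.splits)
  with deg obtain a b c e where n: "n = [:b, a:]" and d: "d = [:e, c:]" by metis
  \<comment> \<open>The difference \<open>n(s) d(t) - n(t) d(s)\<close> equals
    \<open>(a e - b c) (s - t)\<close>. If the determinant vanished, two distinct arguments off
    \<open>E\<close> and the poles would share a value.\<close>
  have "a * e - b * c \<noteq> 0"
  proof
    assume "a * e - b * c = 0"
    then have ae: "complex_of_real a * of_real e = of_real b * of_real c"
      by (metis diff_eq_eq add_0 of_real_mult)
    let ?S = "- (E \<union> {t. poly ?D t = 0})"
    have "finite (E \<union> {t. poly ?D t = 0})"
      using assms(1) \<open>d \<noteq> 0\<close> by (simp add: poly_roots_finite)
    then have infS: "infinite ?S" by (simp add: infinite_UNIV_char_0 finite_compl Compl_eq_Diff_UNIV)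
    then obtain s where s: "s \<in> ?S" by (metis ex_in_conv finite.emptyI)
    from infS have "infinite (?S - {s})" by simp
    then obtain t where t: "t \<in> ?S" "t \<noteq> s" by (metis DiffE ex_in_conv finite.emptyI insertCI)
    have "poly ?N s * poly ?D t = poly ?N t * poly ?D s"
      using ae by (simp add: n d map_poly_pCons) algebra
    with s t have "poly ?N s / poly ?D s = poly ?N t / poly ?D t" by (simp add: field_simps)
    with s t inj show False unfolding f by (auto dest: inj_onD)
  qed
  with \<psi> n d show ?thesis unfolding moebius_transformation_def by blast
qed

section \<open>Passing between real and complex parameters\<close>

lemma infinite_real_if_MOST:
  assumes "\<forall>\<^sub>\<infinity>t::complex. Q t"
  shows "infinite {t::real. Q (of_real t)}"
proof -
  have "finite (complex_of_real -` {t. \<not> Q t})"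
    using assms by (intro finite_vimageI) (auto simp: eventually_cofinite inj_on_def)
  then have "finite (- {t::real. Q (of_real t)})"
    by (rule rev_finite_subset) auto
  then show ?thesis
    using finite_compl[of "{t::real. Q (of_real t)}"] by (auto simp: infinite_UNIV_char_0)
qed

text \<open>Leaving out \<open>t = 0\<close> makes it possible to deduce the value at 0 from the
  other real arguments; this is how points at infinity of a plane are reached below.\<close>

lemma complex_poly_eq_0_if_real_roots:
  fixes Q :: "complex poly"
  assumes "\<And>t::real. t \<noteq> 0 \<Longrightarrow> poly Q (of_real t) = 0"
  shows "Q = 0"
proof (rule ccontr)
  assume "Q \<noteq> 0"
  then have "\<forall>\<^sub>\<infinity>t. poly Q t \<noteq> 0 \<and> t \<noteq> 0"
    using MOST_poly_nonzero[of Q] MOST_poly_nonzero[of "[:0, 1:]"] by (simp add: MOST_conj_distrib)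
  then have "infinite {t::real. poly Q (of_real t) \<noteq> 0 \<and> complex_of_real t \<noteq> 0}"
    by (rule infinite_real_if_MOST)
  with assms show False by (metis (mono_tags, lifting) Collect_empty_eq finite.emptyI of_real_0)
qed

section \<open>Homogeneous coordinates\<close>

lemma proj_rel_refl: "u \<noteq> 0 \<Longrightarrow> proj_rel u u"
  by (auto simp: proj_rel_def intro!: exI[of _ 1])

lemma abs_proj_eq_iff:
  assumes "u \<noteq> 0" "v \<noteq> 0"
  shows "abs_proj u = abs_proj v \<longleftrightarrow> (\<exists>c. c \<noteq> 0 \<and> v = c *s u)"
proof -
  have "proj_rel u v \<longleftrightarrow> proj_rel u u \<and> proj_rel v v \<and> abs_proj u = abs_proj v"
    using Quotient_rel[OF Quotient_proj, of u v] by simp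
  with assms proj_rel_refl show ?thesis by (auto simp: proj_rel_def)
qed

lemma abs_proj_cases:
  obtains u where "u \<noteq> 0" "p = abs_proj u"
proof
  show "p = abs_proj (rep_proj p)"
    using Quotient_abs_rep[OF Quotient_proj] by metis
  show "rep_proj p \<noteq> 0"
    using Quotient_rep_reflp[OF Quotient_proj, of p] by (auto simp: proj_rel_def)
qed

text \<open>Equality of projective points becomes a system of polynomial equations, to which root
  counting applies. At an index \<open>k\<close> with \<open>u $ k\<close> nonzero the scalar is
  \<open>v $ k / u $ k\<close>.\<close>

lemma abs_proj_eq_iff_minors:
  assumes "u \<noteq> 0" "v \<noteq> 0"
  shows "abs_proj u = abs_proj v \<longleftrightarrow> (\<forall>i j. u $ i * v $ j = u $ j * v $ i)"
proof
  assume "abs_proj u = abs_proj v"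
  then show "\<forall>i j. u $ i * v $ j = u $ j * v $ i"
    using assms by (auto simp: abs_proj_eq_iff)
next
  assume minors: "\<forall>i j. u $ i * v $ j = u $ j * v $ i"
  obtain k where k: "u $ k \<noteq> 0" using assms by (auto simp: vec_eq_iff)
  have v: "v = (v $ k / u $ k) *s u"
    using minors[rule_format, of k] k by (simp add: vec_eq_iff field_simps)
  with assms have "v $ k / u $ k \<noteq> 0" by (metis vector_smult_lzero)
  with v show "abs_proj u = abs_proj v"
    using assms by (subst abs_proj_eq_iff) blast+
qed

lemma vanishes_at_abs_proj: "u \<noteq> 0 \<Longrightarrow> vanishes_at d F (abs_proj u) \<longleftrightarrow> form d F u = 0"
  by (simp add: vanishes_at.abs_eq proj_rel_refl)

lemma form_quotient_abs_proj:
  "u \<noteq> 0 \<Longrightarrow> form_quotient d F G (abs_proj u) = form d F u / form d G u"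
  by (simp add: form_quotient.abs_eq proj_rel_refl)

definition homogenize :: "'a::field ^ 3 \<Rightarrow> 'a ^ 4" where
  "homogenize v = vector [v $ 1, v $ 2, v $ 3, 1]"

lemma homogenize_nth [simp]:
  "homogenize v $ 1 = v $ 1" "homogenize v $ 2 = v $ 2" "homogenize v $ 3 = v $ 3"
  "homogenize v $ 4 = 1"
  by (simp_all add: homogenize_def vector_4)

lemma homogenize_nonzero [simp]: "homogenize v \<noteq> 0"
  by (metis homogenize_nth(4) zero_index zero_neq_one)

lemma affine_point_eq: "affine_point v = abs_proj (homogenize v)"
  by (simp add: affine_point_def homogenize_def)

definition cvec :: "real ^ 'n \<Rightarrow> complex ^ 'n" where
  "cvec v = (\<chi> i. complex_of_real (v $ i))"

lemma cvec_nth [simp]: "cvec v $ i = of_real (v $ i)"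
  by (simp add: cvec_def)

lemma cvec_eq_0_iff [simp]: "cvec v = 0 \<longleftrightarrow> v = 0"
  by (simp add: vec_eq_iff)

lemma complexify_abs_proj: "u \<noteq> 0 \<Longrightarrow> complexify (abs_proj u) = abs_proj (cvec u)"
  by (simp add: complexify.abs_eq proj_rel_refl cvec_def)

lemma complexify_affine_point: "complexify (affine_point v) = affine_point (cvec v)"
proof -
  have "cvec (homogenize v) = homogenize (cvec v)"
    by (simp add: vec_eq_iff forall_4)
  then show ?thesis by (simp add: affine_point_eq complexify_abs_proj)
qed

definition dot :: "'a::field ^ 'n \<Rightarrow> 'a ^ 'n \<Rightarrow> 'a" where
  "dot m v = (\<Sum>i\<in>UNIV. m $ i * v $ i)"

lemma dot_linear [simp]:
  "dot m (u + v) = dot m u + dot m v" "dot m (u - v) = dot m u - dot m v"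
  "dot m (c *s u) = c * dot m u"
  by (simp_all add: dot_def algebra_simps sum.distrib sum_subtractf sum_distrib_left)

lemma dot_cvec: "dot (cvec m) (cvec v) = of_real (dot m v)"
  by (simp add: dot_def)

text \<open>Exponents of total degree 1 are indicators of a single index, and at the indicator of
  \<open>k\<close> the coefficient collapses to \<open>m $ k\<close>. Thus the equation of a plane
  can be tested against \<open>proj_closure\<close>.\<close>

lemma form_1:
  fixes m v :: "'a::field ^ 'n"
  shows "form 1 (\<lambda>e. \<Sum>i\<in>UNIV. m $ i * of_nat (e i)) v = dot m v"
proof -
  define E where "E = (\<lambda>i j :: 'n. if j = i then 1 else 0 :: nat)"
  have "{e :: 'n \<Rightarrow> nat. (\<Sum>i\<in>UNIV. e i) = 1} = range E"
  proof safe
    fix e :: "'n \<Rightarrow> nat" assume "sum e UNIV = 1"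
    then obtain k where "e k = 1" "\<And>j. j \<noteq> k \<Longrightarrow> e j = 0"
      by (auto simp: sum_eq_Suc0_iff)
    then have "e = E k" by (auto simp: E_def)
    then show "e \<in> range E" by simp
  qed (simp add: E_def)
  moreover have "inj E"
    by (auto simp: inj_def E_def fun_eq_iff split: if_splits)
  ultimately have "form 1 (\<lambda>e. \<Sum>i\<in>UNIV. m $ i * of_nat (e i)) v
      = (\<Sum>k\<in>UNIV. (\<Sum>i\<in>UNIV. m $ i * of_nat (E k i)) * (\<Prod>i\<in>UNIV. (v $ i) ^ E k i))"
    by (simp add: form_def sum.reindex)
  also have "\<dots> = (\<Sum>k\<in>UNIV. m $ k * v $ k)"
  proof (rule sum.cong)
    fix k
    have "(\<Sum>i\<in>UNIV. m $ i * of_nat (E k i)) = (\<Sum>i\<in>UNIV. if i = k then m $ i else 0)"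
      by (intro sum.cong) (auto simp: E_def)
    moreover have "(\<Prod>i\<in>UNIV. (v $ i) ^ E k i) = (\<Prod>i\<in>UNIV. if i = k then v $ i else 1)"
      by (intro prod.cong) (auto simp: E_def)
    ultimately show "(\<Sum>i\<in>UNIV. m $ i * of_nat (E k i)) * (\<Prod>i\<in>UNIV. (v $ i) ^ E k i) = m $ k * v $ k"
      by simp
  qed simp
  finally show ?thesis by (simp add: dot_def)
qed

section \<open>Polynomially parametrized curves in projective space\<close>

definition ev :: "'a::comm_semiring_0 poly ^ 'n \<Rightarrow> 'a \<Rightarrow> 'a ^ 'n" where
  "ev V t = (\<chi> i. poly (V $ i) t)"

lemma ev_nth [simp]: "ev V t $ i = poly (V $ i) t"
  by (simp add: ev_def)

definition form_poly :: "nat \<Rightarrow> (('n::finite \<Rightarrow> nat) \<Rightarrow> 'a::field) \<Rightarrow> 'a poly ^ 'n \<Rightarrow> 'a poly" where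
  "form_poly d F V = (\<Sum>e | (\<Sum>i\<in>UNIV. e i) = d. smult (F e) (\<Prod>i\<in>UNIV. (V $ i) ^ e i))"

lemma poly_form_poly: "poly (form_poly d F V) t = form d F (ev V t)"
  by (simp add: form_poly_def form_def poly_sum poly_prod)

text \<open>A form composed with \<open>V\<close> is a polynomial in one variable; if it vanishes at
  infinitely many parameters, it vanishes at all of them.\<close>

lemma in_proj_closure_if_infinite:
  assumes inf: "infinite {t. ev V t \<noteq> 0 \<and> abs_proj (ev V t) \<in> proj_closure S}"
    and "ev V t \<noteq> 0"
  shows "abs_proj (ev V t) \<in> proj_closure S"
  unfolding proj_closure_def
proof (intro CollectI allI impI)
  fix d F
  assume "\<forall>v\<in>S. vanishes_at d F (complexify (affine_point v))"
  then have "{t. ev V t \<noteq> 0 \<and> abs_proj (ev V t) \<in> proj_closure S}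
      \<subseteq> {t. poly (form_poly d F V) t = 0}"
    by (auto simp: proj_closure_def poly_form_poly vanishes_at_abs_proj)
  with inf have "form_poly d F V = 0"
    by (intro poly_eq_0_if_infinite_roots) (rule infinite_super)
  then show "vanishes_at d F (abs_proj (ev V t))"
    using assms(2) by (simp add: vanishes_at_abs_proj flip: poly_form_poly)
qed

text \<open>Passing through \<open>q\<close> means that all minors of \<open>V\<close> against
  \<open>q\<close> vanish. As the image is not just \<open>q\<close>, some minor is a nonzero
  polynomial, with finitely many roots.\<close>

lemma MOST_abs_proj_neq:
  fixes V :: "'a::field poly ^ 'n"
  assumes inf: "infinite ((\<lambda>t. abs_proj (ev V t)) ` {t. ev V t \<noteq> 0})"
  shows "\<forall>\<^sub>\<infinity>t. ev V t \<noteq> 0 \<longrightarrow> abs_proj (ev V t) \<noteq> q"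
proof -
  obtain w where w: "w \<noteq> 0" "q = abs_proj w" by (rule abs_proj_cases)
  have "\<not> (\<lambda>t. abs_proj (ev V t)) ` {t. ev V t \<noteq> 0} \<subseteq> {q}"
    using inf finite_subset by blast
  then obtain t0 where "ev V t0 \<noteq> 0" "abs_proj (ev V t0) \<noteq> q" by blast
  with w obtain i j where ij: "ev V t0 $ i * w $ j \<noteq> ev V t0 $ j * w $ i"
    using abs_proj_eq_iff_minors by blast
  define Q where "Q = smult (w $ j) (V $ i) - smult (w $ i) (V $ j)"
  have Q: "poly Q t = ev V t $ i * w $ j - ev V t $ j * w $ i" for t
    by (simp add: Q_def mult.commute)
  have "poly Q t0 \<noteq> 0" using ij by (simp add: Q)
  then have "Q \<noteq> 0" by auto
  from MOST_poly_nonzero[OF this] show ?thesis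
  proof eventually_elim
    case (elim t)
    with w show ?case
      using abs_proj_eq_iff_minors[of "ev V t" w] unfolding Q by auto
  qed
qed

text \<open>Multiplying by all three denominators may introduce common zeros of the components, but
  only at poles, that is, outside \<open>param_dom\<close>.\<close>

definition hom_param :: "rat poly fract ^ 3 \<Rightarrow> complex poly ^ 4" where
  "hom_param x = (let n = (\<lambda>i. map_poly of_rat (fst (quot_of_fract (x $ i))));
                      d = (\<lambda>i. map_poly of_rat (snd (quot_of_fract (x $ i))))
     in vector [n 1 * d 2 * d 3, d 1 * n 2 * d 3, d 1 * d 2 * n 3, d 1 * d 2 * d 3])"

lemma hom_param:
  assumes "t \<in> param_dom x"
  shows "ev (hom_param x) t \<noteq> 0" and "affine_point (param x t) = abs_proj (ev (hom_param x) t)"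
proof -
  define c where "c = poly (hom_param x $ 4) t"
  have nz: "poly (map_poly of_rat (snd (quot_of_fract (x $ i)))) t \<noteq> 0" for i
    using assms by (simp add: param_dom_def ratfun_dom_def)
  then have "c \<noteq> 0" by (simp add: c_def hom_param_def Let_def vector_4)
  moreover have ev: "ev (hom_param x) t = c *s homogenize (param x t)"
    using nz by (simp add: vec_eq_iff forall_4 c_def hom_param_def Let_def vector_4 param_def ratfun_def)
  ultimately show "ev (hom_param x) t \<noteq> 0" by (simp add: vector_mul_eq_0)
  with ev \<open>c \<noteq> 0\<close> show "affine_point (param x t) = abs_proj (ev (hom_param x) t)"
    unfolding affine_point_eq by (subst abs_proj_eq_iff) auto
qed

lemma hom_param_real: "poly (hom_param x $ i) (of_real t) \<in> \<real>"
proof -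
  have "\<forall>i. poly (hom_param x $ i) (of_real t) \<in> \<real>"
    unfolding forall_4 by (simp add: hom_param_def Let_def vector_4 poly_map_poly_of_rat)
  then show ?thesis ..
qed

lemma of_real_in_param_dom_iff: "complex_of_real t \<in> param_dom x \<longleftrightarrow> t \<in> param_dom x"
  by (simp add: param_dom_def ratfun_dom_def poly_map_poly_of_rat)

lemma param_of_real: "param x (complex_of_real t) = cvec (param x t)"
  by (simp add: param_def vec_eq_iff ratfun_def poly_map_poly_of_rat)

lemma param_cnj: "param x (cnj t) $ i = cnj (param x t $ i)"
  by (simp add: param_def ratfun_def poly_map_poly_of_rat_cnj)

lemma real_point_in_curve:
  assumes "complex_of_real t \<in> param_dom x"
  shows "affine_point (param x (complex_of_real t)) \<in> curve x"
  using assms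
  by (auto simp: curve_def proj_closure_def real_curve_def of_real_in_param_dom_iff
      param_of_real complexify_affine_point)

text \<open>\<open>curve\<close> is the closure of points with real parameters only. These are
  infinitely many, so the closure contains the points with complex parameters as well.\<close>

lemma affine_point_in_curve:
  assumes "\<forall>\<^sub>\<infinity>t::complex. t \<in> param_dom x" and t: "t \<in> param_dom x"
  shows "affine_point (param x t) \<in> curve x"
proof -
  let ?V = "hom_param x"
  have "infinite {t::real. complex_of_real t \<in> param_dom x}"
    using assms(1) by (rule infinite_real_if_MOST)
  then have "infinite (complex_of_real ` {t. complex_of_real t \<in> param_dom x})"
    by (simp add: finite_image_iff inj_on_def)
  moreover have "complex_of_real ` {t. complex_of_real t \<in> param_dom x}
      \<subseteq> {t. ev ?V t \<noteq> 0 \<and> abs_proj (ev ?V t) \<in> proj_closure (real_curve x)}"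
    using real_point_in_curve hom_param unfolding curve_def by fastforce
  ultimately have "infinite {t. ev ?V t \<noteq> 0 \<and> abs_proj (ev ?V t) \<in> proj_closure (real_curve x)}"
    using finite_subset by blast
  then have "abs_proj (ev ?V t) \<in> proj_closure (real_curve x)"
    by (rule in_proj_closure_if_infinite) (rule hom_param(1)[OF t])
  then show ?thesis
    using hom_param(2)[OF t] by (simp add: curve_def)
qed

text \<open>The rational inverse makes the parametrization injective on all but finitely many real
  parameters.\<close>

lemma infinite_curve:
  assumes "proper_param x"
  shows "infinite (curve x)"
proof -
  obtain d F G where MOST: "\<forall>\<^sub>\<infinity>t::complex. t \<in> param_dom x \<and>
        \<not> vanishes_at d G (affine_point (param x t)) \<and>
        form_quotient d F G (affine_point (param x t)) = t"
    using assms unfolding proper_param_def by blast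
  define T where "T = {t::real. complex_of_real t \<in> param_dom x \<and>
      form_quotient d F G (affine_point (param x (complex_of_real t))) = complex_of_real t}"
  have "infinite T"
    unfolding T_def by (rule infinite_real_if_MOST) (use MOST in \<open>auto elim: MOST_mono\<close>)
  moreover have "inj_on (\<lambda>t. affine_point (param x (complex_of_real t))) T"
    by (rule inj_onI) (metis (mono_tags, lifting) T_def mem_Collect_eq of_real_eq_iff)
  moreover have "(\<lambda>t. affine_point (param x (complex_of_real t))) ` T \<subseteq> curve x"
    using real_point_in_curve by (auto simp: T_def)
  ultimately show ?thesis by (meson finite_imageD finite_subset)
qed

section \<open>Central projection in coordinates\<close>

text \<open>The equation of the plane is itself a form, which gives one direction. Conversely, a
  form vanishing on \<open>P\<close> is shown to vanish at real affine points, then at real points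
  at infinity, then at complex points.\<close>

lemma proj_closure_plane:
  assumes "is_plane P"
  obtains m :: "real ^ 4"
  where "\<And>u. u \<noteq> 0 \<Longrightarrow> abs_proj u \<in> proj_closure P \<longleftrightarrow> dot (cvec m) u = 0"
proof -
  have "affine P" "aff_dim P = int (DIM(real ^ 3) - 1)"
    using assms by (simp_all add: is_plane_def)
  then obtain n c where "n \<noteq> 0" and P: "P = {v. n \<bullet> v = c}"
    by (metis aff_dim_eq_hyperplane affine_hull_eq)
  define m :: "real ^ 4" where "m = vector [n $ 1, n $ 2, n $ 3, - c]"
  have m: "dot m (homogenize v) = n \<bullet> v - c" for v
    by (simp add: dot_def sum_4 m_def vector_4 inner_vec_def sum_3)
  have "P \<noteq> {}" using assms by (auto simp: is_plane_def)
  then obtain p0 where p0: "p0 \<in> P" by blast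
  show ?thesis
  proof (rule that[of m])
    fix u :: "complex ^ 4" assume "u \<noteq> 0"
    show "abs_proj u \<in> proj_closure P \<longleftrightarrow> dot (cvec m) u = 0"
    proof
      assume u: "abs_proj u \<in> proj_closure P"
      let ?F = "\<lambda>e. \<Sum>i\<in>UNIV. cvec m $ i * of_nat (e i)"
      have "vanishes_at 1 ?F (complexify (affine_point v))" if "v \<in> P" for v
      proof -
        have "complexify (affine_point v) = abs_proj (cvec (homogenize v))"
          by (simp add: affine_point_eq complexify_abs_proj)
        moreover have "dot m (homogenize v) = 0" using m that P by simp
        ultimately show ?thesis
          by (simp only: vanishes_at_abs_proj cvec_eq_0_iff homogenize_nonzero not_False_eq_True
              form_1 dot_cvec of_real_0)
      qed
      with u have "vanishes_at 1 ?F (abs_proj u)" unfolding proj_closure_def by blast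
      with \<open>u \<noteq> 0\<close> show "dot (cvec m) u = 0"
        by (simp only: vanishes_at_abs_proj not_False_eq_True form_1)
    next
      assume u: "dot (cvec m) u = 0"
      show "abs_proj u \<in> proj_closure P"
        unfolding proj_closure_def
      proof (intro CollectI allI impI)
        fix d F
        assume van: "\<forall>v\<in>P. vanishes_at d F (complexify (affine_point v))"
        have affine: "form d F (cvec w) = 0" if "dot m w = 0" "w $ 4 \<noteq> 0" for w
        proof -
          define v :: "real ^ 3" where "v = vector [w $ 1 / w $ 4, w $ 2 / w $ 4, w $ 3 / w $ 4]"
          have w: "w = w $ 4 *s homogenize v"
            using that(2) by (simp add: vec_eq_iff forall_4 v_def)
          then have "w $ 4 * dot m (homogenize v) = 0" using that(1) by (metis dot_linear(3))
          with that(2) m P have "v \<in> P" by simp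
          with van have "form d F (cvec (homogenize v)) = 0"
            by (metis affine_point_eq complexify_abs_proj cvec_eq_0_iff homogenize_nonzero
                vanishes_at_abs_proj)
          moreover have "cvec w = of_real (w $ 4) *s cvec (homogenize v)"
            by (subst w) (simp add: vec_eq_iff)
          ultimately show ?thesis by (simp only: form_scale mult_zero_right)
        qed
        have real: "form d F (cvec w) = 0" if w: "dot m w = 0" for w
        proof (cases "w $ 4 = 0")
          case True
          \<comment> \<open>Adding \<open>t\<close> times the affine point \<open>p0\<close> to
            \<open>w\<close> gives fourth coordinate \<open>t\<close>. The affine case covers real
            nonzero \<open>t\<close>, and the polynomial identity then yields
            \<open>t = 0\<close>.\<close>
          define V :: "complex poly ^ 4" where
            "V = (\<chi> i. [:of_real (w $ i), of_real (homogenize p0 $ i):])"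
          have "form_poly d F V = 0"
          proof (rule complex_poly_eq_0_if_real_roots)
            fix t :: real assume "t \<noteq> 0"
            have "ev V (of_real t) = cvec (w + t *s homogenize p0)"
              by (simp add: vec_eq_iff V_def)
            moreover have "dot m (w + t *s homogenize p0) = 0" using w m p0 P by simp
            ultimately show "poly (form_poly d F V) (of_real t) = 0"
              using affine True \<open>t \<noteq> 0\<close> by (simp add: poly_form_poly)
          qed
          then have "form d F (ev V 0) = 0" by (simp flip: poly_form_poly)
          moreover have "ev V 0 = cvec w" by (simp add: vec_eq_iff V_def)
          ultimately show ?thesis by simp
        qed (use affine w in blast)
        \<comment> \<open>Both \<open>a\<close> and \<open>b\<close> satisfy the real equation,
          hence so does \<open>a + t b\<close> for real \<open>t\<close>; the value at
          \<open>t = \<i>\<close> is \<open>u\<close>.\<close>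
        define V :: "complex poly ^ 4" where
          "V = (\<chi> i. [:of_real (Re (u $ i)), of_real (Im (u $ i)):])"
        define a b :: "real ^ 4" where "a = (\<chi> i. Re (u $ i))" and "b = (\<chi> i. Im (u $ i))"
        have ab: "dot m a = 0" "dot m b = 0"
          using arg_cong[OF u, of Re] arg_cong[OF u, of Im] by (simp_all add: dot_def a_def b_def)
        have "form_poly d F V = 0"
        proof (rule complex_poly_eq_0_if_real_roots)
          fix t :: real
          have "ev V (of_real t) = cvec (a + t *s b)"
            by (simp add: vec_eq_iff V_def a_def b_def)
          then show "poly (form_poly d F V) (of_real t) = 0"
            using real ab by (simp add: poly_form_poly)
        qed
        then have "form d F (ev V \<i>) = 0" by (simp flip: poly_form_poly)
        moreover have "ev V \<i> = u" by (simp add: vec_eq_iff V_def complex_eq_iff)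
        ultimately show "vanishes_at d F (abs_proj u)"
          using \<open>u \<noteq> 0\<close> by (simp add: vanishes_at_abs_proj)
      qed
    qed
  qed
qed

definition central :: "'a::field ^ 'n \<Rightarrow> 'a ^ 'n \<Rightarrow> 'a ^ 'n \<Rightarrow> 'a ^ 'n" where
  "central m a u = dot m a *s u - dot m u *s a"

definition central_poly :: "'a::field ^ 'n \<Rightarrow> 'a ^ 'n \<Rightarrow> 'a poly ^ 'n \<Rightarrow> 'a poly ^ 'n" where
  "central_poly m a V = (\<chi> i. smult (dot m a) (V $ i) - smult (a $ i) (\<Sum>j\<in>UNIV. smult (m $ j) (V $ j)))"

lemma ev_central_poly: "ev (central_poly m a V) t = central m a (ev V t)"
  by (simp add: vec_eq_iff central_poly_def central_def poly_sum mult.commute dot_def)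

text \<open>A combination of \<open>\<alpha>\<close> and \<open>u\<close> is killed by
  \<open>dot m\<close> only if it is a multiple of \<open>central m \<alpha> u\<close>, because
  \<open>dot m \<alpha>\<close> is nonzero. That vector is nonzero because \<open>u\<close> and
  \<open>\<alpha>\<close> are not proportional.\<close>

lemma projection_central:
  assumes plane: "\<And>u. u \<noteq> 0 \<Longrightarrow> abs_proj u \<in> proj_closure P \<longleftrightarrow> dot m u = 0"
    and a: "complexify a = abs_proj \<alpha>" "\<alpha> \<noteq> 0" "dot m \<alpha> \<noteq> 0"
    and u: "u \<noteq> 0" "abs_proj u \<noteq> complexify a"
  shows "central m \<alpha> u \<noteq> 0" and "projection P a (abs_proj u) = abs_proj (central m \<alpha> u)"
proof -
  show nz: "central m \<alpha> u \<noteq> 0"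
  proof
    assume "central m \<alpha> u = 0"
    then have eq: "dot m \<alpha> *s u = dot m u *s \<alpha>" by (simp add: central_def)
    then have "u = (dot m u / dot m \<alpha>) *s \<alpha>"
      using a by (simp add: vec_eq_iff field_simps)
    moreover from this have "dot m u / dot m \<alpha> \<noteq> 0"
      using u(1) by (metis vector_smult_lzero)
    ultimately have "abs_proj \<alpha> = abs_proj u"
      using a u(1) by (subst abs_proj_eq_iff) blast+
    with a u show False by simp
  qed
  have on: "on_line (abs_proj \<alpha>) (abs_proj u) (abs_proj w) \<longleftrightarrow> (\<exists>c d. w = c *s \<alpha> + d *s u)"
    if "w \<noteq> 0" for w
    using a u that by (simp add: on_line.abs_eq proj_rel_refl)
  show "projection P a (abs_proj u) = abs_proj (central m \<alpha> u)"
    unfolding projection_def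
  proof (rule the_equality)
    have "central m \<alpha> u = (- dot m u) *s \<alpha> + dot m \<alpha> *s u"
      by (simp add: central_def vec_eq_iff)
    with nz on have "on_line (abs_proj \<alpha>) (abs_proj u) (abs_proj (central m \<alpha> u))" by blast
    moreover have "dot m (central m \<alpha> u) = 0" by (simp add: central_def)
    ultimately show "abs_proj (central m \<alpha> u) \<in> proj_closure P \<inter> proj_line (complexify a) (abs_proj u)"
      using plane nz a by (simp add: proj_line_def)
  next
    fix q assume q: "q \<in> proj_closure P \<inter> proj_line (complexify a) (abs_proj u)"
    obtain w where w: "w \<noteq> 0" "q = abs_proj w" by (rule abs_proj_cases)
    with q a on have "\<exists>c d. w = c *s \<alpha> + d *s u" by (simp add: proj_line_def)
    then obtain c d where cd: "w = c *s \<alpha> + d *s u" by blast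
    have "dot m w = 0" using q w plane by simp
    then have "c * dot m \<alpha> + d * dot m u = 0" by (simp add: cd)
    then have c: "c = - d * dot m u / dot m \<alpha>"
      using a by (simp add: field_simps eq_neg_iff_add_eq_0)
    then have eq: "w = (d / dot m \<alpha>) *s central m \<alpha> u"
      using a(3) by (simp add: cd c central_def vec_eq_iff field_simps)
    then have "d / dot m \<alpha> \<noteq> 0" using w by (metis vector_smult_lzero)
    with eq have "abs_proj (central m \<alpha> u) = abs_proj w"
      using nz w by (subst abs_proj_eq_iff) blast+
    with w show "q = abs_proj (central m \<alpha> u)" by simp
  qed
qed

lemma affine_point_real:
  assumes "affine_point w = abs_proj v" "v \<noteq> 0" "\<And>i. v $ i \<in> \<real>"
  shows "cnj (w $ i) = w $ i"
proof -
  obtain c where c: "c \<noteq> 0" "v = c *s homogenize w"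
    using assms(1,2) unfolding affine_point_eq by (subst (asm) abs_proj_eq_iff) auto
  have c4: "c = v $ 4" by (simp add: c(2))
  \<comment> \<open>The conditional translates the three affine indices into indices of the four
    homogeneous coordinates.\<close>
  have "\<forall>i. w $ i = v $ (if i = 1 then 1 else if i = 2 then 2 else 3) / c"
    using c(1) unfolding forall_3 by (simp add: c(2))
  then have "w $ i = v $ (if i = 1 then 1 else if i = 2 then 2 else 3) / v $ 4"
    using c4 by blast
  then have "w $ i \<in> \<real>" using assms(3) by (metis Reals_divide)
  then show ?thesis by (simp add: Reals_cnj_iff)
qed

section \<open>The induced map of parameters\<close>

theorem theorem3:
  fixes x1 x2 :: "rat poly fract ^ 3"
    and P :: "(real ^ 3) set"
    and a :: "(real, 4) proj"
  assumes "proper_param x1" and "proper_param x2"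
    and "curve x1 \<noteq> curve x2"
    and "is_plane P" and "real_curve x2 \<subseteq> P"
    and "\<not> (\<exists>Q. is_plane Q \<and> real_curve x1 \<subseteq> Q \<and> real_curve x2 \<subseteq> Q)"
    and "\<not> (\<exists>L. is_straight_line L \<and> curve x1 = proj_closure L)"
    and "\<not> (\<exists>L. is_straight_line L \<and> curve x2 = proj_closure L)"
    and "complexify a \<notin> proj_closure P"
    and "projects_onto P a (curve x1) (curve x2)"
  shows "\<exists>\<psi> :: real poly fract.
     (\<forall>\<^sub>\<infinity>t::complex.
        t \<in> param_dom x1 \<and> affine_point (param x1 t) \<noteq> complexify a \<and>
        t \<in> ratfun_dom of_real \<psi> \<and> ratfun of_real \<psi> t \<in> param_dom x2 \<and>
        projection P a (affine_point (param x1 t)) = affine_point (param x2 (ratfun of_real \<psi> t)))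
     \<and> (nondegenerate_projection P a (curve x1) (curve x2) \<longrightarrow> moebius_transformation \<psi>)"
proof -
  let ?C1 = "curve x1" and ?C2 = "curve x2" and ?p1 = "\<lambda>t::complex. affine_point (param x1 t)"
    and ?p2 = "\<lambda>t::complex. affine_point (param x2 t)"
  obtain d1 F1 G1 where
    proper1: "\<forall>\<^sub>\<infinity>t::complex. t \<in> param_dom x1 \<and> \<not> vanishes_at d1 G1 (?p1 t) \<and>
        form_quotient d1 F1 G1 (?p1 t) = t" and
    fin1: "finite {p \<in> ?C1. \<not> (\<not> vanishes_at d1 G1 p \<and> form_quotient d1 F1 G1 p \<in> param_dom x1 \<and>
        ?p1 (form_quotient d1 F1 G1 p) = p)}"
    using assms(1) unfolding proper_param_def by blast
  obtain d F G where
    proper2: "\<forall>\<^sub>\<infinity>t::complex. t \<in> param_dom x2 \<and> \<not> vanishes_at d G (?p2 t) \<and>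
        form_quotient d F G (?p2 t) = t" and
    fin2: "finite {p \<in> ?C2. \<not> (\<not> vanishes_at d G p \<and> form_quotient d F G p \<in> param_dom x2 \<and>
        ?p2 (form_quotient d F G p) = p)}"
    using assms(2) unfolding proper_param_def by blast
  have dom1: "\<forall>\<^sub>\<infinity>t::complex. t \<in> param_dom x1"
    using proper1 by (rule MOST_mono) blast

  \<comment> \<open>The projected first curve in coordinates\<close>
  obtain m :: "real ^ 4"
    where plane: "\<And>u. u \<noteq> 0 \<Longrightarrow> abs_proj u \<in> proj_closure P \<longleftrightarrow> dot (cvec m) u = 0"
    using proj_closure_plane[OF assms(4)] by blast
  obtain \<alpha> where \<alpha>: "\<alpha> \<noteq> 0" "a = abs_proj \<alpha>" by (rule abs_proj_cases)
  have a: "complexify a = abs_proj (cvec \<alpha>)" "cvec \<alpha> \<noteq> 0"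
    using \<alpha> by (simp_all add: complexify_abs_proj)
  then have a': "dot (cvec m) (cvec \<alpha>) \<noteq> 0" using plane assms(9) by metis
  define V where "V = central_poly (cvec m) (cvec \<alpha>) (hom_param x1)"
  let ?v = "\<lambda>t. abs_proj (ev V t)"
  define T where "T = {t. t \<in> param_dom x1 \<and> ?p1 t \<noteq> complexify a}"
  have V: "ev V t \<noteq> 0" "projection P a (?p1 t) = ?v t" if "t \<in> T" for t
  proof -
    note h = hom_param[of t x1]
    from that h have u: "ev (hom_param x1) t \<noteq> 0" "abs_proj (ev (hom_param x1) t) \<noteq> complexify a"
      and e: "?p1 t = abs_proj (ev (hom_param x1) t)"
      by (auto simp: T_def)
    show "ev V t \<noteq> 0" "projection P a (?p1 t) = ?v t"
      using projection_central[OF plane a a' u] unfolding e V_def ev_central_poly by auto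
  qed
  have MOST_T: "\<forall>\<^sub>\<infinity>t. t \<in> T"
  proof -
    \<comment> \<open>Where \<open>F1 / G1\<close> inverts the parametrization, the eye point can
      occur only at the one parameter that this quotient assigns to it.\<close>
    have "\<forall>\<^sub>\<infinity>t. t \<noteq> form_quotient d1 F1 G1 (complexify a)"
      by (simp add: eventually_cofinite)
    with proper1 show ?thesis
      by eventually_elim (auto simp: T_def)
  qed

  \<comment> \<open>The projected curve lies on the second curve\<close>
  let ?J = "{t \<in> T. ?v t \<in> ?C2}"
  \<comment> \<open>Each point of the second curve is the projection of an exceptional point in the
    finite set \<open>B\<close> or of some \<open>?p1 s\<close> with \<open>s\<close> in
    \<open>T\<close>. A finite image would therefore make the second curve finite.\<close>
  have infJ: "infinite (?v ` ?J)"
  proof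
    assume fin: "finite (?v ` ?J)"
    define B where "B = {p \<in> ?C1. \<not> (\<not> vanishes_at d1 G1 p \<and>
        form_quotient d1 F1 G1 p \<in> param_dom x1 \<and> ?p1 (form_quotient d1 F1 G1 p) = p)}"
    have "?C2 \<subseteq> projection P a ` B \<union> ?v ` ?J"
    proof
      fix q assume q: "q \<in> ?C2"
      then obtain p where p: "p \<in> ?C1" "p \<noteq> complexify a" "projection P a p = q"
        using assms(10) unfolding projects_onto_def by blast
      show "q \<in> projection P a ` B \<union> ?v ` ?J"
      proof (cases "p \<in> B")
        case True
        with p show ?thesis by blast
      next
        case False
        with p obtain s where s: "s \<in> param_dom x1" "?p1 s = p" unfolding B_def by blast
        with p have "s \<in> T" by (simp add: T_def)
        moreover from this have "?v s = q" using V(2) s p by metis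
        ultimately show ?thesis using q by blast
      qed
    qed
    moreover have "finite B" unfolding B_def by (rule fin1)
    ultimately show False
      using fin infinite_curve[OF assms(2)] by (meson finite_UnI finite_imageI finite_subset)
  qed
  then have "infinite ?J" using finite_imageI by blast
  then have "infinite {t. ev V t \<noteq> 0 \<and> ?v t \<in> proj_closure (real_curve x2)}"
    by (rule infinite_super[rotated]) (use V in \<open>auto simp: curve_def\<close>)
  then have C2: "?v t \<in> ?C2" if "t \<in> T" for t
    unfolding curve_def by (rule in_proj_closure_if_infinite) (rule V(1)[OF that])
  have "infinite (?v ` {t. ev V t \<noteq> 0})"
    using infJ by (rule infinite_super[rotated]) (use V in auto)
  then have avoid: "\<forall>\<^sub>\<infinity>t. ev V t \<noteq> 0 \<longrightarrow> ?v t \<noteq> q" for q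
    by (rule MOST_abs_proj_neq)
  have avoid_finite: "\<forall>\<^sub>\<infinity>t. ?v t \<notin> B" if "finite B" for B
  proof -
    have "\<forall>\<^sub>\<infinity>t. \<forall>q\<in>B. ev V t \<noteq> 0 \<longrightarrow> ?v t \<noteq> q"
      using that avoid by (intro eventually_ball_finite) auto
    with MOST_T show ?thesis by eventually_elim (use V in blast)
  qed

  \<comment> \<open>The parameter map and its real coefficients\<close>
  define N D where "N = form_poly d F V" and "D = form_poly d G V"
  let ?s = "\<lambda>t. poly N t / poly D t"
  \<comment> \<open>Almost every \<open>?v t\<close> avoids the finitely many points where
    \<open>F / G\<close> fails to invert the second parametrization, so \<open>?s t\<close> is a
    parameter of \<open>?v t\<close>.\<close>
  have generic: "\<forall>\<^sub>\<infinity>t. t \<in> T \<and> poly D t \<noteq> 0 \<and> form_quotient d F G (?v t) = ?s t \<and>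
      ?s t \<in> param_dom x2 \<and> ?p2 (?s t) = ?v t"
    using MOST_T avoid_finite[OF fin2]
  proof eventually_elim
    case (elim t)
    have s: "form_quotient d F G (?v t) = ?s t"
      using V(1) elim by (simp add: form_quotient_abs_proj N_def D_def poly_form_poly)
    have "vanishes_at d G (?v t) \<longleftrightarrow> poly D t = 0"
      using V(1) elim by (simp add: vanishes_at_abs_proj D_def poly_form_poly)
    with s elim C2[of t] show ?case by simp
  qed
  have "D \<noteq> 0"
  proof
    assume "D = 0"
    with generic have "\<forall>\<^sub>\<infinity>t::complex. False" by simp
    then show False by (simp add: infinite_UNIV_char_0)
  qed

  \<comment> \<open>For real \<open>t\<close> both \<open>s = N(t)/D(t)\<close> and its conjugate are parameters of the real point
    \<open>?v t\<close>, so they agree unless the conjugate is one of the finitely many parameters where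
    the inverse \<open>F / G\<close> of the second parametrization fails.\<close>
  have real: "\<forall>\<^sub>\<infinity>t. t \<in> \<real> \<longrightarrow> ?s t \<in> \<real> \<and> poly D t \<noteq> 0"
  proof -
    define E where "E = {t::complex. \<not> (t \<in> param_dom x2 \<and> \<not> vanishes_at d G (?p2 t) \<and>
        form_quotient d F G (?p2 t) = t)}"
    \<comment> \<open>If the conjugate of \<open>?s t\<close> were in \<open>E\<close>, conjugating
      twice would place \<open>?v t\<close> in this finite set, which almost all \<open>t\<close>
      avoid.\<close>
    have "finite ((\<lambda>u. ?p2 (cnj u)) ` E)"
      using proper2 unfolding E_def by (simp add: eventually_cofinite)
    from generic avoid_finite[OF this] show ?thesis
    proof eventually_elim
      case (elim t)
      show ?case
      proof
        assume "t \<in> \<real>"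
        then obtain r where r: "t = of_real r" by (auto elim: Reals_cases)
        let ?h = "ev (hom_param x1) t"
        have h: "?h $ i \<in> \<real>" for i by (simp add: r hom_param_real)
        have "dot (cvec m) ?h \<in> \<real>"
          using h by (auto simp: dot_def intro!: sum_in_Reals Reals_mult)
        then have "ev V t $ i \<in> \<real>" for i
          using h unfolding V_def ev_central_poly central_def dot_cvec
          by (auto intro!: Reals_diff Reals_mult)
        then have "cnj (param x2 (?s t) $ i) = param x2 (?s t) $ i" for i
          using elim V(1) by (intro affine_point_real[of _ "ev V t"]) auto
        then have "param x2 (cnj (?s t)) = param x2 (?s t)"
          by (simp add: vec_eq_iff param_cnj del: complex_cnj_divide)
        then have q: "?p2 (cnj (?s t)) = ?v t" using elim by (simp del: complex_cnj_divide)
        have "cnj (?s t) \<notin> E"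
        proof
          assume "cnj (?s t) \<in> E"
          then have "?p2 (cnj (cnj (?s t))) \<in> (\<lambda>u. ?p2 (cnj u)) ` E" by (rule imageI)
          with elim show False by (simp del: complex_cnj_divide)
        qed
        then have "form_quotient d F G (?v t) = cnj (?s t)" unfolding E_def using q by auto
        with elim show "?s t \<in> \<real> \<and> poly D t \<noteq> 0" by (metis Reals_cnj_iff)
      qed
    qed
  qed
  have "infinite {t::real. ?s (of_real t) \<in> \<real> \<and> poly D (of_real t) \<noteq> 0}"
    using infinite_real_if_MOST[OF real] by simp
  from real_ratfun_exists[OF \<open>D \<noteq> 0\<close> this] obtain \<psi> :: "real poly fract"
    where \<psi>: "\<forall>\<^sub>\<infinity>t::complex. t \<in> ratfun_dom of_real \<psi> \<and> ratfun of_real \<psi> t = ?s t"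
    by blast
  let ?\<psi> = "ratfun of_real \<psi> :: complex \<Rightarrow> complex"
  have main: "\<forall>\<^sub>\<infinity>t::complex.
        t \<in> param_dom x1 \<and> ?p1 t \<noteq> complexify a \<and>
        t \<in> ratfun_dom of_real \<psi> \<and> ?\<psi> t \<in> param_dom x2 \<and> projection P a (?p1 t) = ?p2 (?\<psi> t)"
    using generic \<psi> by eventually_elim (use V(2) in \<open>auto simp: T_def\<close>)

  \<comment> \<open>Non-degenerate projections\<close>
  moreover have "moebius_transformation \<psi>" if nd: "nondegenerate_projection P a ?C1 ?C2"
  proof -
    define B where "B = {q \<in> ?C2. \<not> (\<exists>!p. p \<in> ?C1 \<and> p \<noteq> complexify a \<and> projection P a p = q)}"
    have "finite B" using nd by (simp add: B_def nondegenerate_projection_def)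
    define Q where "Q t \<longleftrightarrow> t \<in> T \<and> ?v t \<notin> B \<and> form_quotient d1 F1 G1 (?p1 t) = t \<and>
        projection P a (?p1 t) = ?p2 (?\<psi> t)" for t
    have "\<forall>\<^sub>\<infinity>t. Q t"
      using MOST_T avoid_finite[OF \<open>finite B\<close>] proper1 main
      by eventually_elim (simp add: Q_def)
    then have "finite {t. \<not> Q t}" by (simp add: eventually_cofinite)
    then show ?thesis
    proof (rule moebius_if_injective)
      show "inj_on ?\<psi> (- {t. \<not> Q t})"
      \<comment> \<open>Equal values of \<open>?\<psi>\<close> give the same projected point.
        Outside \<open>B\<close> it has only one preimage on the first curve, and
        \<open>F1 / G1\<close> recovers the parameter from that preimage.\<close>
      proof (rule inj_onI)
        fix t u assume tu: "t \<in> - {t. \<not> Q t}" "u \<in> - {t. \<not> Q t}" "?\<psi> t = ?\<psi> u"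
        then have Q: "Q t" "Q u" by simp_all
        have "?p1 t \<in> ?C1" "?p1 u \<in> ?C1" "?p1 t \<noteq> complexify a" "?p1 u \<noteq> complexify a"
          using Q affine_point_in_curve[OF dom1] by (simp_all add: Q_def T_def)
        moreover have "projection P a (?p1 t) = ?v t" "projection P a (?p1 u) = ?v t"
          using Q tu(3) V(2) unfolding Q_def by metis+
        moreover have "\<exists>!p. p \<in> ?C1 \<and> p \<noteq> complexify a \<and> projection P a p = ?v t"
          using Q C2 unfolding Q_def B_def by blast
        ultimately have "?p1 t = ?p1 u" by blast
        with Q show "t = u" unfolding Q_def by metis
      qed
    qed
  qed
  ultimately show ?thesis by blast
qed

end
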